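(* In the offline-to-online $K$-armed bandit setting with offline counts $\mathbf m=(m_1,\dots,m_K)$ described in the context, for any $T\ge 1$ and any algorithm $\mathcal A$, \[ \mathcal R_{\mathcal A}(T)\ge \frac{1}{31}\,T\sqrt{\max_{J\subseteq[K]}\frac{|J|}{T-1+\sum_{j\in J}m_j}} . \]
   Context: There are $K$ arms; arm $i$ has an unknown $1$-subgaussian reward distribution $\mathcal P_i$ (i.e. $\int \exp(\lambda(x-\mu_i))\mathcal P_i(dx)\le\exp(\lambda^2/2)$ for all real $\lambda$) with mean $\mu_i$. A fixed non-random vector $\mathbf m$ of nonnegative integers is given, and before interaction the learner observes $m_i$ i.i.d. samples from $\mathcal P_i$ for each $i$. An instance is $(\mathcal P_1,\dots,\mathcal P_K)$ together with $\mathbf m$; $\Theta_{\mathbf m}$ is the set of all such instances with $1$-subgaussian distributions. In online rounds $t=1,\dots,T$ the learner (algorithm $\mathcal A$, using offline data and past online observations) pulls $I(t)$ and observes an independent reward from $\mathcal P_{I(t)}$. With $\mu^*=\max_i\mu_i$, the pseudo-regret is $R(T)=T\mu^*-\sum_{t=1}^T\mu_{I(t)}$ and $\mathcal R_{\mathcal A}(T)=\sup_{\theta\in\Theta_{\mathbf m}}\mathbb E_{\theta,\mathcal A}[R(T)]$, the expectation being over offline data, online rewards and the algorithm's randomness.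
   Formalization: The formal theorem assumes at least two arms (K ≥ 2); for K = 1 the regret is identically 0 while the right-hand side is positive, so the statement as written fails there. *)

theory Defs
  imports "HOL-Probability.Probability"
begin

text \<open>Arms are indexed 0..K-1. An instance is a family P of real-valued
  probability measures (only P i for i < K matter).\<close>

definition mean :: "real measure \<Rightarrow> real" where
  "mean P = (\<integral>x. x \<partial>P)"

definition subgaussian1 :: "real measure \<Rightarrow> bool" where
  "subgaussian1 P \<longleftrightarrow> prob_space P \<and> sets P = sets borel \<and> integrable P (\<lambda>x. x) \<and>
     (\<forall>l::real. (\<integral>\<^sup>+x. ennreal (exp (l * (x - mean P))) \<partial>P) \<le> ennreal (exp (l\<^sup>2 / 2)))"

definition instances :: "nat \<Rightarrow> (nat \<Rightarrow> real measure) set" where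
  "instances K = {P. \<forall>i<K. subgaussian1 (P i)}"

type_synonym history = "(nat \<times> real) list"

text \<open>Reward-table model: X (i,s) is the s-th sample of arm i; the first m i
  samples of arm i are the offline data, the online pulls of arm i reveal
  X (i, m i), X (i, m i + 1), ... in order.\<close>
definition offline_view :: "nat \<Rightarrow> (nat \<Rightarrow> nat) \<Rightarrow> (nat \<times> nat \<Rightarrow> real) \<Rightarrow> nat \<Rightarrow> nat \<Rightarrow> real" where
  "offline_view K m X = (\<lambda>i s. if i < K \<and> s < m i then X (i, s) else 0)"

text \<open>An algorithm: internal randomness u, offline data, online history \<mapsto> arm.\<close>
fun hist :: "('u \<Rightarrow> (nat \<Rightarrow> nat \<Rightarrow> real) \<Rightarrow> history \<Rightarrow> nat) \<Rightarrow> nat \<Rightarrow> (nat \<Rightarrow> nat)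
    \<Rightarrow> 'u \<Rightarrow> (nat \<times> nat \<Rightarrow> real) \<Rightarrow> nat \<Rightarrow> history" where
  "hist \<pi> K m u X 0 = []"
| "hist \<pi> K m u X (Suc t) =
     (let h = hist \<pi> K m u X t; a = \<pi> u (offline_view K m X) h
      in h @ [(a, X (a, m a + length (filter (\<lambda>p. fst p = a) h)))])"

text \<open>Arm pulled in online round t+1.\<close>
definition arm :: "('u \<Rightarrow> (nat \<Rightarrow> nat \<Rightarrow> real) \<Rightarrow> history \<Rightarrow> nat) \<Rightarrow> nat \<Rightarrow> (nat \<Rightarrow> nat)
    \<Rightarrow> 'u \<Rightarrow> (nat \<times> nat \<Rightarrow> real) \<Rightarrow> nat \<Rightarrow> nat" where
  "arm \<pi> K m u X t = \<pi> u (offline_view K m X) (hist \<pi> K m u X t)"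

definition sample_space :: "'u measure \<Rightarrow> nat \<Rightarrow> (nat \<Rightarrow> real measure) \<Rightarrow> ('u \<times> (nat \<times> nat \<Rightarrow> real)) measure" where
  "sample_space R K P = R \<Otimes>\<^sub>M (\<Pi>\<^sub>M j\<in>UNIV. (if fst j < K then P (fst j) else return borel 0))"

definition valid_algorithm :: "'u measure \<Rightarrow> ('u \<Rightarrow> (nat \<Rightarrow> nat \<Rightarrow> real) \<Rightarrow> history \<Rightarrow> nat)
    \<Rightarrow> nat \<Rightarrow> (nat \<Rightarrow> nat) \<Rightarrow> bool" where
  "valid_algorithm R \<pi> K m \<longleftrightarrow> prob_space R \<and> (\<forall>u D h. \<pi> u D h < K) \<and>
     (\<forall>t. (\<lambda>\<omega>. arm \<pi> K m (fst \<omega>) (snd \<omega>) t)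
            \<in> measurable (R \<Otimes>\<^sub>M (\<Pi>\<^sub>M j\<in>UNIV. (borel :: real measure))) (count_space UNIV))"

definition pseudo_regret :: "nat \<Rightarrow> (nat \<Rightarrow> real measure) \<Rightarrow> nat \<Rightarrow> (nat \<Rightarrow> nat) \<Rightarrow> real" where
  "pseudo_regret K P T I = (\<Sum>t<T. Max {mean (P i) | i. i < K} - mean (P (I t)))"

definition exp_regret :: "'u measure \<Rightarrow> ('u \<Rightarrow> (nat \<Rightarrow> nat \<Rightarrow> real) \<Rightarrow> history \<Rightarrow> nat)
    \<Rightarrow> nat \<Rightarrow> (nat \<Rightarrow> nat) \<Rightarrow> (nat \<Rightarrow> real measure) \<Rightarrow> nat \<Rightarrow> ennreal" where
  "exp_regret R \<pi> K m P T =
     (\<integral>\<^sup>+\<omega>. ennreal (pseudo_regret K P T (arm \<pi> K m (fst \<omega>) (snd \<omega>))) \<partial>sample_space R K P)"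

definition worst_regret :: "'u measure \<Rightarrow> ('u \<Rightarrow> (nat \<Rightarrow> nat \<Rightarrow> real) \<Rightarrow> history \<Rightarrow> nat)
    \<Rightarrow> nat \<Rightarrow> (nat \<Rightarrow> nat) \<Rightarrow> nat \<Rightarrow> ennreal" where
  "worst_regret R \<pi> K m T = (SUP P\<in>instances K. exp_regret R \<pi> K m P T)"

definition ennsqrt :: "ennreal \<Rightarrow> ennreal" where
  "ennsqrt x = (if x = \<top> then \<top> else ennreal (sqrt (enn2real x)))"

text \<open>Lower bound; division in ennreal, so c / 0 = \<infinity> for c > 0.\<close>
definition lower_bound :: "nat \<Rightarrow> (nat \<Rightarrow> nat) \<Rightarrow> nat \<Rightarrow> ennreal" where
  "lower_bound K m T = ennreal (1/31) * of_nat T *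
     ennsqrt (Max {of_nat (card J) / of_nat (T - 1 + sum m J) | J. J \<subseteq> {..<K}})"

end

theory Submission
  imports Defs
begin

text \<open>
  Perturb the instance in which all arms are standard Gaussians by shifting the mean of a single
  arm \<open>j\<close>. An event that depends on only \<open>n\<close> samples of arm \<open>j\<close> changes its probability by at most
  \<open>sqrt (exp (d\<^sup>2 n) - 1) / 2\<close> under a shift by \<open>d\<close>, since \<open>exp (d\<^sup>2 n)\<close> is the second moment of the
  likelihood ratio.

  If \<open>card J \<le> 11\<close>, a single arm of \<open>J\<close> already suffices: shift it by \<open>d\<close> and by \<open>- d\<close>, and test with
  the events \<open>I(t) = j\<close>, which see at most \<open>T - 1 + m j\<close> samples of arm \<open>j\<close>. The lost factor
  \<open>sqrt (card J)\<close> is absorbed by the constant.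

  If \<open>k = card J \<ge> 12\<close>, shift one arm \<open>j\<close> of \<open>J\<close> upwards and test with the event that it is
  pulled at most \<open>r = 4 (T - 1) div k\<close> times. Whether this happens is determined by the first
  \<open>m j + r\<close> samples of arm \<open>j\<close>, so a fixed sample size replaces the random number of pulls and no
  chain rule for adaptively collected data is needed. Since the pulls add up to \<open>T\<close>, averaging
  over \<open>J\<close> yields an arm for which the event is likely in the unperturbed instance and \<open>m j\<close> is
  not too large.
\<close>

section \<open>Product measures, densities, and the second-moment bound on event
  probabilities\<close>

lemma nn_integral_PiM_prod:
  assumes M: "\<And>i. prob_space (M i)" and J: "finite J" "J \<subseteq> I"
    and f: "\<And>i. i \<in> J \<Longrightarrow> f i \<in> borel_measurable (M i)"
  shows "(\<integral>\<^sup>+x. (\<Prod>i\<in>J. f i (x i)) \<partial>PiM I M) = (\<Prod>i\<in>J. \<integral>\<^sup>+x. f i x \<partial>M i)"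
proof -
  interpret prob_space "M i" for i by fact
  interpret product_prob_space M I by unfold_locales
  have meas: "(\<lambda>x. \<Prod>i\<in>J. f i (x i)) \<in> borel_measurable (PiM J M)"
    by (intro borel_measurable_prod_ennreal measurable_compose[OF measurable_component_singleton[where M=M] f])
  \<comment> \<open>The integrand sees only the finitely many coordinates in \<open>J\<close>, so
    \<open>PiM I M\<close> may be replaced by its marginal on \<open>J\<close>, where the finite
    product formula applies.\<close>
  have "(\<integral>\<^sup>+x. (\<Prod>i\<in>J. f i (x i)) \<partial>PiM I M)
      = (\<integral>\<^sup>+x. (\<Prod>i\<in>J. f i (restrict x J i)) \<partial>PiM I M)"
    by (intro nn_integral_cong prod.cong) auto
  also have "\<dots> = (\<integral>\<^sup>+x. (\<Prod>i\<in>J. f i (x i)) \<partial>distr (PiM I M) (PiM J M) (\<lambda>x. restrict x J))"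
    using meas J(2) by (subst nn_integral_distr) (auto intro!: measurable_restrict_subset)
  also have "\<dots> = (\<Prod>i\<in>J. \<integral>\<^sup>+x. f i x \<partial>M i)"
    using J f by (subst distr_PiM_restrict_finite) (auto intro!: product_nn_integral_prod)
  finally show ?thesis .
qed

text \<open>A product measure is determined by its values on cylinders, and on a cylinder the
  integral of the product density splits coordinate by coordinate.\<close>

lemma PiM_density:
  assumes M: "\<And>i. prob_space (M i)" and J: "finite J" "J \<subseteq> I"
    and l [measurable]: "\<And>i. l i \<in> borel_measurable (M i)"
    and N: "\<And>i. i \<in> J \<Longrightarrow> prob_space (density (M i) (l i))"
  shows "PiM I (\<lambda>i. if i \<in> J then density (M i) (l i) else M i)
       = density (PiM I M) (\<lambda>x. \<Prod>i\<in>J. l i (x i))" (is "PiM I ?N = ?D")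
proof -
  have pN: "prob_space (?N i)" for i using M N by auto
  interpret M: prob_space "M i" for i by fact
  interpret N: prob_space "?N i" for i by (rule pN)
  interpret N: product_prob_space ?N I by unfold_locales
  have setsP: "sets (PiM I ?N) = sets (PiM I M)" by (rule sets_PiM_cong) auto
  have Lm: "(\<lambda>x. \<Prod>i\<in>J. l i (x i)) \<in> borel_measurable (PiM I M)"
    using J by (intro borel_measurable_prod_ennreal measurable_compose[OF measurable_component_singleton[where M=M] l]) auto
  show ?thesis
  proof (rule N.PiM_eq[symmetric])
    show "sets ?D = sets (PiM I ?N)" using setsP by simp
    fix H F assume H: "finite H" "H \<subseteq> I" and F: "\<And>j. j \<in> H \<Longrightarrow> F j \<in> sets (?N j)"
    have F': "F j \<in> sets (M j)" if "j \<in> H" for j using F[OF that] by (simp split: if_splits)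
    let ?E = "prod_emb I ?N H (Pi\<^sub>E H F)"
    have E: "?E \<in> sets (PiM I M)"
      using H F by (subst setsP[symmetric]) (intro sets_PiM_I, auto)
    \<comment> \<open>\<open>g\<close> merges density and cylinder constraint into one factor per
      coordinate, so the integrand is a single product over \<open>J \<union> H\<close>. A
      coordinate of \<open>J\<close> outside \<open>H\<close> contributes 1 because its density is
      normalised.\<close>
    define g where "g i x = (if i \<in> J then l i x else 1) * (if i \<in> H then indicator (F i) x else 1)"
      for i x
    have gm: "g i \<in> borel_measurable (M i)" for i
      unfolding g_def using F'[of i] l[of i]
      by (cases "i \<in> J"; cases "i \<in> H") (auto intro!: borel_measurable_times_ennreal borel_measurable_indicator)
    have gint: "(\<integral>\<^sup>+x. g i x \<partial>M i) = (if i \<in> H then emeasure (?N i) (F i) else 1)" for i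
    proof (cases "i \<in> J")
      case True
      then have "emeasure (density (M i) (l i)) (space (density (M i) (l i))) = 1"
        using N prob_space.emeasure_space_1 by blast
      then have "(\<integral>\<^sup>+x. l i x \<partial>M i) = 1"
        by (simp add: emeasure_density cong: nn_integral_cong)
      with True F'[of i] show ?thesis by (auto simp: g_def emeasure_density)
    next
      case False
      with F'[of i] show ?thesis by (auto simp: g_def M.emeasure_space_1)
    qed
    have "emeasure ?D ?E = (\<integral>\<^sup>+x. (\<Prod>i\<in>J. l i (x i)) * indicator ?E x \<partial>PiM I M)"
      by (rule emeasure_density[OF Lm E])
    also have "\<dots> = (\<integral>\<^sup>+x. (\<Prod>i\<in>J \<union> H. g i (x i)) \<partial>PiM I M)"
    proof (rule nn_integral_cong)
      fix x assume x: "x \<in> space (PiM I M)"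
      then have xE: "x \<in> ?E \<longleftrightarrow> (\<forall>i\<in>H. x i \<in> F i)"
        using H by (auto simp: prod_emb_def space_PiM PiE_iff)
      have "indicator ?E x = (\<Prod>i\<in>H. indicator (F i) (x i) :: ennreal)"
        using H(1) by (auto simp: indicator_def xE intro!: prod_zero[symmetric] prod.neutral[symmetric])
      also have "\<dots> = (\<Prod>i\<in>J \<union> H. if i \<in> H then indicator (F i) (x i) else 1)"
        using H(1) J(1) by (intro prod.mono_neutral_cong_left) auto
      finally have 1: "indicator ?E x = (\<Prod>i\<in>J \<union> H. if i \<in> H then indicator (F i) (x i) else 1 :: ennreal)" .
      have 2: "(\<Prod>i\<in>J. l i (x i)) = (\<Prod>i\<in>J \<union> H. if i \<in> J then l i (x i) else 1)"
        using H(1) J(1) by (intro prod.mono_neutral_cong_left) auto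
      show "(\<Prod>i\<in>J. l i (x i)) * indicator ?E x = (\<Prod>i\<in>J \<union> H. g i (x i))"
        unfolding 1 2 g_def by (simp add: prod.distrib)
    qed
    also have "\<dots> = (\<Prod>i\<in>J \<union> H. \<integral>\<^sup>+x. g i x \<partial>M i)"
      using J H gm by (intro nn_integral_PiM_prod M) auto
    also have "\<dots> = (\<Prod>i\<in>H. emeasure (?N i) (F i))"
      unfolding gint using H(1) J(1) by (intro prod.mono_neutral_cong_right) auto
    finally show "emeasure ?D ?E = (\<Prod>i\<in>H. emeasure (?N i) (F i))" .
  qed
qed

text \<open>Both sides equal the probability of one and the same event under the common marginal on
  \<open>-Z\<close>. This is needed because shifting an arm changes infinitely many samples, which
  no finite product of likelihood ratios describes.\<close>

lemma emeasure_PiM_cong_irrelevant: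
  fixes M M' :: "'i \<Rightarrow> real measure"
  assumes M: "\<And>i. prob_space (M i)" "\<And>i. sets (M i) = sets borel"
    and M': "\<And>i. prob_space (M' i)" "\<And>i. sets (M' i) = sets borel"
    and eq: "\<And>i. i \<notin> Z \<Longrightarrow> M i = M' i"
    and A: "A \<in> sets (\<Pi>\<^sub>M i\<in>UNIV. borel)"
    and dep: "\<And>x y. (\<And>i. i \<notin> Z \<Longrightarrow> x i = y i) \<Longrightarrow> x \<in> A \<Longrightarrow> y \<in> A"
  shows "emeasure (PiM UNIV M) A = emeasure (PiM UNIV M') A"
proof -
  \<comment> \<open>\<open>e\<close> fills the coordinates in \<open>Z\<close> with 0. The value is
    arbitrary: \<open>A\<close> ignores these coordinates, so restricting to \<open>-Z\<close> and
    applying \<open>e\<close> pulls \<open>A\<close> back to itself.\<close>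
  define e where "e x i = (if i \<in> Z then 0 else x i)" for x :: "'i \<Rightarrow> real" and i
  have em [measurable]: "e \<in> measurable (\<Pi>\<^sub>M i\<in>-Z. borel) (\<Pi>\<^sub>M i\<in>UNIV. borel)"
  proof (rule measurable_PiM_single')
    show "(\<lambda>x. e x i) \<in> borel_measurable (\<Pi>\<^sub>M i\<in>-Z. borel)" for i
      unfolding e_def by (cases "i \<in> Z") auto
  qed auto
  let ?B = "e -` A \<inter> space (\<Pi>\<^sub>M i\<in>-Z. borel)"
  have B: "?B \<in> sets (\<Pi>\<^sub>M i\<in>-Z. borel)" using em A by (rule measurable_sets)
  have main: "emeasure (PiM UNIV L) A = emeasure (PiM (-Z) L) ?B"
    if L: "\<And>i. prob_space (L i)" "\<And>i. sets (L i) = sets borel" for L :: "'i \<Rightarrow> real measure"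
  proof -
    have sU: "sets (PiM UNIV L) = sets (\<Pi>\<^sub>M i\<in>UNIV. borel)" and
         sZ: "sets (PiM (-Z) L) = sets (\<Pi>\<^sub>M i\<in>-Z. borel)"
      using L(2) by (auto intro!: sets_PiM_cong)
    have spU: "space (PiM UNIV L) = UNIV"
      using sets_eq_imp_space_eq[OF sU] by (simp add: space_PiM)
    \<comment> \<open>Reindexing along the identity yields the marginal on \<open>-Z\<close> even
      when \<open>-Z\<close> is infinite.\<close>
    have "PiM (-Z) L = distr (PiM UNIV L) (PiM (-Z) L) (\<lambda>x. \<lambda>n\<in>-Z. x n)"
      using distr_PiM_reindex[of UNIV L id "-Z"] L(1) by simp
    then have "emeasure (PiM (-Z) L) ?B
        = emeasure (distr (PiM UNIV L) (PiM (-Z) L) (\<lambda>x. \<lambda>n\<in>-Z. x n)) ?B" by simp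
    also have "\<dots> = emeasure (PiM UNIV L) ((\<lambda>x. \<lambda>n\<in>-Z. x n) -` ?B \<inter> space (PiM UNIV L))"
      using B sZ by (intro emeasure_distr measurable_restrict_subset) auto
    also have "(\<lambda>x. \<lambda>n\<in>-Z. x n) -` ?B \<inter> space (PiM UNIV L) = A"
    proof -
      have "e (restrict x (-Z)) \<in> A \<longleftrightarrow> x \<in> A" for x
        using dep[of "e (restrict x (-Z))" x] dep[of x "e (restrict x (-Z))"]
        by (auto simp: e_def)
      then show ?thesis unfolding spU by (auto simp: space_PiM)
    qed
    finally show ?thesis by simp
  qed
  have "PiM (-Z) M = PiM (-Z) M'" using eq by (intro PiM_cong) auto
  then show ?thesis using main[OF M] main[OF M'] by simp
qed

text \<open>Bounds total variation by chi-squared distance: \<open>s\<^sup>2\<close> bounds the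
  variance of the likelihood ratio \<open>L\<close>.\<close>

lemma (in prob_space) density_event_diff_le:
  fixes L :: "'a \<Rightarrow> real"
  assumes L [measurable]: "L \<in> borel_measurable M" and pos: "\<And>x. 0 \<le> L x"
    and one: "(\<integral>\<^sup>+x. L x \<partial>M) = 1" and sq: "(\<integral>\<^sup>+x. (L x)\<^sup>2 \<partial>M) \<le> ennreal (1 + s\<^sup>2)"
    and s: "0 < s" and A [measurable]: "A \<in> sets M"
  shows "\<bar>measure (density M L) A - prob A\<bar> \<le> s / 2"
proof -
  have int: "integrable M L" and E1: "expectation L = 1"
    using one pos by (auto intro!: integrableI_nonneg simp: integral_eq_nn_integral)
  have fin: "(\<integral>\<^sup>+x. (L x)\<^sup>2 \<partial>M) < \<infinity>" using sq by (rule le_less_trans) simp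
  have int2: "integrable M (\<lambda>x. (L x)\<^sup>2)"
    using fin by (intro integrableI_nonneg) auto
  have E2: "expectation (\<lambda>x. (L x)\<^sup>2) \<le> 1 + s\<^sup>2"
    using sq by (simp add: integral_eq_nn_integral enn2real_leI)
  have intA: "integrable M (\<lambda>x. L x * indicator A x)"
    using integrable_mult_indicator[OF A int] by (simp add: mult.commute)
  have intI: "integrable M (indicator A :: 'a \<Rightarrow> real)" by (simp add: emeasure_eq_measure)
  have "emeasure (density M L) A = (\<integral>\<^sup>+x. ennreal (L x * indicator A x) \<partial>M)"
    by (subst emeasure_density) (auto intro!: nn_integral_cong simp: indicator_def)
  also have "\<dots> = ennreal (expectation (\<lambda>x. L x * indicator A x))"
    using intA pos by (intro nn_integral_eq_integral) auto
  finally have mA: "measure (density M L) A = expectation (\<lambda>x. L x * indicator A x)"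
    using pos by (simp add: measure_def)
  \<comment> \<open>As \<open>L - 1\<close> has expectation 0, the indicator may be centred at 1/2.
    This gains a factor 2, since the centred indicator has absolute value exactly 1/2.\<close>
  define f where "f x = (L x - 1) * (indicator A x - 1 / 2)" for x
  have f_eq: "f x = L x * indicator A x - indicator A x - (L x - 1) / 2" for x
    by (simp add: f_def field_simps)
  have intf: "integrable M f" unfolding f_eq using int intA intI by auto
  have "expectation f = measure (density M L) A - prob A"
    unfolding f_eq using int intA intI E1 by (simp add: mA prob_space)
  \<comment> \<open>A pointwise AM-GM inequality with weight \<open>s\<close> replaces
    Cauchy-Schwarz. With \<open>s\<close> as the bound on the standard deviation of
    \<open>L\<close>, the final estimate is the same.\<close>
  moreover have "\<bar>f x\<bar> \<le> (s + ((L x)\<^sup>2 - 2 * L x + 1) / s) / 4" for x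
  proof -
    have "\<bar>f x\<bar> = \<bar>L x - 1\<bar> / 2"
      by (simp add: f_def abs_mult indicator_def)
    moreover have "0 \<le> (s - \<bar>L x - 1\<bar>)\<^sup>2 / s" using s by simp
    then have "2 * \<bar>L x - 1\<bar> \<le> s + (L x - 1)\<^sup>2 / s"
      using s by (simp add: power2_eq_square field_simps)
    moreover have "(L x - 1)\<^sup>2 = (L x)\<^sup>2 - 2 * L x + 1"
      by (simp add: power2_eq_square algebra_simps)
    ultimately show ?thesis by simp
  qed
  then have "expectation (\<lambda>x. \<bar>f x\<bar>) \<le> expectation (\<lambda>x. (s + ((L x)\<^sup>2 - 2 * L x + 1) / s) / 4)"
    using intf int int2 by (intro integral_mono) auto
  moreover have "\<dots> = (s + (expectation (\<lambda>x. (L x)\<^sup>2) - 1) / s) / 4"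
    using int int2 E1 by (simp add: prob_space)
  moreover have "\<dots> \<le> s / 2"
  proof -
    have "(expectation (\<lambda>x. (L x)\<^sup>2) - 1) / s \<le> s\<^sup>2 / s"
      using E2 s by (intro divide_right_mono) auto
    moreover have "s\<^sup>2 / s = s" using s by (simp add: power2_eq_square)
    moreover have "(s + y) / 4 \<le> s / 2" if "y \<le> s" for y using that by simp
    ultimately show ?thesis by metis
  qed
  moreover have "\<bar>expectation f\<bar> \<le> expectation (\<lambda>x. \<bar>f x\<bar>)" by (rule integral_abs_bound)
  ultimately show ?thesis by linarith
qed

section \<open>Unit-variance Gaussians: subgaussianity and likelihood ratios\<close>

definition gauss :: "real \<Rightarrow> real measure" where
  "gauss \<mu> = density lborel (normal_density \<mu> 1)"

lemma prob_space_gauss: "prob_space (gauss \<mu>)"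
  unfolding gauss_def by (rule prob_space_normal_density) simp

lemma sets_gauss [simp, measurable_cong]: "sets (gauss \<mu>) = sets borel"
  by (simp add: gauss_def)

lemma space_gauss [simp]: "space (gauss \<mu>) = UNIV"
  by (simp add: gauss_def)

text \<open>Completing the square. This one identity gives both the exponential moments and the
  likelihood ratio of a shift.\<close>

lemma normal_density_tilt:
  "normal_density \<mu> 1 x * exp (l * (x - \<mu>)) = exp (l\<^sup>2 / 2) * normal_density (\<mu> + l) 1 x"
proof -
  have "- (x - \<mu>)\<^sup>2 / 2 + l * (x - \<mu>) = l\<^sup>2 / 2 + - (x - (\<mu> + l))\<^sup>2 / 2"
    by (simp add: power2_eq_square field_simps)
  then show ?thesis by (simp add: normal_density_def exp_add[symmetric])
qed

lemma nn_integral_gauss_exp: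
  "(\<integral>\<^sup>+x. ennreal (exp (l * (x - \<mu>))) \<partial>gauss \<mu>) = ennreal (exp (l\<^sup>2 / 2))"
proof -
  have "(\<integral>\<^sup>+x. ennreal (exp (l * (x - \<mu>))) \<partial>gauss \<mu>)
      = (\<integral>\<^sup>+x. ennreal (exp (l\<^sup>2 / 2)) * ennreal (normal_density (\<mu> + l) 1 x) \<partial>lborel)"
    unfolding gauss_def
    by (subst nn_integral_density)
       (auto intro!: nn_integral_cong simp: ennreal_mult[symmetric] normal_density_tilt)
  also have "\<dots> = ennreal (exp (l\<^sup>2 / 2)) * 1"
    by (subst nn_integral_cmult) (auto simp: nn_integral_eq_integral)
  finally show ?thesis by simp
qed

lemma mean_gauss: "integrable (gauss \<mu>) (\<lambda>x. x)" "mean (gauss \<mu>) = \<mu>"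
proof -
  have *: "has_bochner_integral lborel (\<lambda>x. normal_density \<mu> 1 x * x) \<mu>"
    by (rule normal_moment_nz_1) simp
  show "integrable (gauss \<mu>) (\<lambda>x. x)"
    unfolding gauss_def using integrable.intros[OF *] by (subst integrable_density) auto
  show "mean (gauss \<mu>) = \<mu>"
    unfolding gauss_def mean_def using has_bochner_integral_integral_eq[OF *]
    by (subst integral_density) auto
qed

lemma subgaussian1_gauss: "subgaussian1 (gauss \<mu>)"
  unfolding subgaussian1_def
  by (auto simp: prob_space_gauss mean_gauss nn_integral_gauss_exp)

lemma gauss_eq_density:
  "gauss \<mu> = density (gauss 0) (\<lambda>x. ennreal (exp (\<mu> * x - \<mu>\<^sup>2 / 2)))"
proof -
  have "normal_density 0 1 x * exp (\<mu> * x - \<mu>\<^sup>2 / 2) = normal_density \<mu> 1 x" for x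
    using normal_density_tilt[of 0 x \<mu>] by (simp add: exp_diff)
  then show ?thesis
    unfolding gauss_def by (subst density_density_eq) (auto simp: ennreal_mult[symmetric])
qed

text \<open>The squared likelihood ratio is an exponential with parameter twice the shift, so the
  exponent is \<open>(2 * \<mu>)\<^sup>2 / 2 - \<mu>\<^sup>2 = \<mu>\<^sup>2\<close>.\<close>

lemma nn_integral_gauss_likelihood_sq:
  "(\<integral>\<^sup>+x. ennreal ((exp (\<mu> * x - \<mu>\<^sup>2 / 2))\<^sup>2) \<partial>gauss 0) = ennreal (exp (\<mu>\<^sup>2))"
proof -
  have "(exp (\<mu> * x - \<mu>\<^sup>2 / 2))\<^sup>2 = exp (- \<mu>\<^sup>2) * exp (2 * \<mu> * (x - 0))" for x
    by (simp add: power2_eq_square exp_add[symmetric] algebra_simps)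
  then have "(\<integral>\<^sup>+x. ennreal ((exp (\<mu> * x - \<mu>\<^sup>2 / 2))\<^sup>2) \<partial>gauss 0)
     = (\<integral>\<^sup>+x. ennreal (exp (- \<mu>\<^sup>2)) * ennreal (exp (2 * \<mu> * (x - 0))) \<partial>gauss 0)"
    by (simp add: ennreal_mult[symmetric])
  also have "\<dots> = ennreal (exp (- \<mu>\<^sup>2)) * ennreal (exp ((2 * \<mu>)\<^sup>2 / 2))"
    by (subst nn_integral_cmult) (auto simp only: nn_integral_gauss_exp, auto)
  also have "\<dots> = ennreal (exp (\<mu>\<^sup>2))"
    by (simp add: ennreal_mult[symmetric] exp_add[symmetric] power2_eq_square)
  finally show ?thesis .
qed

section \<open>Gaussian reward tables and the effect of shifting one arm\<close>

definition gauss_table :: "nat \<Rightarrow> (nat \<Rightarrow> real) \<Rightarrow> nat \<times> nat \<Rightarrow> real measure" where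
  "gauss_table K \<mu> = (\<lambda>i. if fst i < K then gauss (\<mu> (fst i)) else return borel 0)"

lemma prob_space_gauss_table: "prob_space (gauss_table K \<mu> i)"
  by (auto simp: gauss_table_def prob_space_gauss intro: prob_space_return)

lemma sets_gauss_table [simp, measurable_cong]: "sets (gauss_table K \<mu> i) = sets borel"
  by (simp add: gauss_table_def)

lemma sets_PiM_gauss_table [simp, measurable_cong]:
  "sets (PiM UNIV (gauss_table K \<mu>)) = sets (\<Pi>\<^sub>M i\<in>UNIV. borel)"
  by (rule sets_PiM_cong) auto

lemma table_event_diff_le:
  assumes j: "j < K" and A: "A \<in> sets (\<Pi>\<^sub>M i\<in>UNIV. borel)"
    and dep: "\<And>x y. (\<And>i. i \<notin> {j} \<times> {n..} \<Longrightarrow> x i = y i) \<Longrightarrow> x \<in> A \<Longrightarrow> y \<in> A"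
    and s: "exp (d\<^sup>2 * real n) \<le> 1 + s\<^sup>2" "0 < s"
  shows "\<bar>measure (PiM UNIV (gauss_table K ((\<lambda>_. 0)(j := d)))) A
        - measure (PiM UNIV (gauss_table K (\<lambda>_. 0))) A\<bar> \<le> s / 2"
proof -
  let ?M = "gauss_table K (\<lambda>_. 0)" and ?M' = "gauss_table K ((\<lambda>_. 0)(j := d))"
  define I where "I = Pair j ` {..<n}"
  define l where "l x = exp (d * x - d\<^sup>2 / 2)" for x :: real
  define L where "L x = (\<Prod>i\<in>I. l (x i))" for x :: "nat \<times> nat \<Rightarrow> real"
  have lm [measurable]: "l \<in> borel_measurable borel" unfolding l_def by measurable
  have lpos: "0 \<le> l x" for x by (simp add: l_def)
  have finI: "finite I" and cardI: "card I = n"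
    by (auto simp: I_def card_image inj_on_def)
  have MI: "?M i = gauss 0" if "i \<in> I" for i using that j by (auto simp: gauss_table_def I_def)
  have dens: "density (?M i) (\<lambda>x. ennreal (l x)) = gauss d" if "i \<in> I" for i
    using MI[OF that] by (simp add: l_def gauss_eq_density[of d])
  \<comment> \<open>A hybrid table: only the first \<open>n\<close> samples of arm \<open>j\<close>
    are shifted. It gives \<open>A\<close> the same probability as the fully shifted table, since
    \<open>A\<close> ignores later samples, and it has the density \<open>L\<close> with respect to
    the unshifted table.\<close>
  let ?N = "\<lambda>i. if i \<in> I then density (?M i) (\<lambda>x. ennreal (l x)) else ?M i"
  interpret P: prob_space "PiM UNIV ?M"
    by (intro prob_space_PiM prob_space_gauss_table)
  have Lm [measurable]: "L \<in> borel_measurable (PiM UNIV ?M)"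
    unfolding L_def by measurable
  have "PiM UNIV ?N = density (PiM UNIV ?M) (\<lambda>x. \<Prod>i\<in>I. ennreal (l (x i)))"
    using finI by (intro PiM_density) (auto simp: prob_space_gauss_table dens prob_space_gauss)
  also have "\<dots> = density (PiM UNIV ?M) (\<lambda>x. ennreal (L x))"
    by (simp add: L_def prod_ennreal lpos)
  finally have N: "PiM UNIV ?N = density (PiM UNIV ?M) (\<lambda>x. ennreal (L x))" .
  have "emeasure (PiM UNIV ?M') A = emeasure (PiM UNIV ?N) A"
  proof (rule emeasure_PiM_cong_irrelevant[where Z="{j} \<times> {n..}"])
    show "prob_space (?N i)" "sets (?N i) = sets borel" for i
      by (auto simp: prob_space_gauss_table dens prob_space_gauss)
    show "?M' i = ?N i" if "i \<notin> {j} \<times> {n..}" for i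
    proof (cases "i \<in> I")
      case True
      then have "?M' i = gauss d" using j by (auto simp: I_def gauss_table_def)
      then show ?thesis using True dens by simp
    next
      case False
      then have "fst i \<noteq> j" using that by (cases i) (auto simp: I_def)
      then show ?thesis using False by (simp add: gauss_table_def)
    qed
  qed (use A dep in \<open>auto simp: prob_space_gauss_table\<close>)
  then have eq: "measure (PiM UNIV ?M') A = measure (density (PiM UNIV ?M) (\<lambda>x. ennreal (L x))) A"
    by (simp add: measure_def N)
  have "(\<integral>\<^sup>+x. ennreal (L x) \<partial>PiM UNIV ?M) = 1"
  proof -
    interpret D: prob_space "density (PiM UNIV ?M) (\<lambda>x. ennreal (L x))"
      unfolding N[symmetric]
      by (intro prob_space_PiM) (auto simp: prob_space_gauss_table dens prob_space_gauss)
    show ?thesis using D.emeasure_space_1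
      by (subst (asm) emeasure_density) (auto cong: nn_integral_cong simp del: sets_PiM_gauss_table)
  qed
  \<comment> \<open>Second moments of likelihood ratios multiply over independent samples, giving
    the exponent \<open>d\<^sup>2 * n\<close>.\<close>
  moreover have "(\<integral>\<^sup>+x. ennreal ((L x)\<^sup>2) \<partial>PiM UNIV ?M) \<le> ennreal (1 + s\<^sup>2)"
  proof -
    have "(\<integral>\<^sup>+x. ennreal ((L x)\<^sup>2) \<partial>PiM UNIV ?M) = (\<integral>\<^sup>+x. (\<Prod>i\<in>I. ennreal ((l (x i))\<^sup>2)) \<partial>PiM UNIV ?M)"
      by (simp add: L_def prod_power_distrib prod_ennreal)
    also have "\<dots> = (\<Prod>i\<in>I. \<integral>\<^sup>+x. ennreal ((l x)\<^sup>2) \<partial>?M i)"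
      using finI by (intro nn_integral_PiM_prod[where f="\<lambda>_ x. ennreal ((l x)\<^sup>2)"])
        (auto simp: prob_space_gauss_table)
    also have "\<dots> = (\<Prod>i\<in>I. ennreal (exp (d\<^sup>2)))"
      by (intro prod.cong refl) (simp add: MI l_def nn_integral_gauss_likelihood_sq)
    also have "\<dots> = ennreal (exp (d\<^sup>2 * real n))"
      by (simp add: cardI ennreal_power exp_of_nat2_mult)
    finally show ?thesis using ennreal_leI[OF s(1)] by simp
  qed
  ultimately show ?thesis unfolding eq using s A
    by (intro P.density_event_diff_le) (auto simp: L_def lpos prod_nonneg)
qed

definition gauss_law :: "'u measure \<Rightarrow> nat \<Rightarrow> (nat \<Rightarrow> real) \<Rightarrow> ('u \<times> (nat \<times> nat \<Rightarrow> real)) measure" where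
  "gauss_law R K \<mu> = R \<Otimes>\<^sub>M PiM UNIV (gauss_table K \<mu>)"

lemma sample_space_gauss: "sample_space R K (\<lambda>i. gauss (\<mu> i)) = gauss_law R K \<mu>"
  by (simp add: sample_space_def gauss_law_def gauss_table_def)

lemma sets_gauss_law [simp, measurable_cong]:
  "sets (gauss_law R K \<mu>) = sets (R \<Otimes>\<^sub>M (\<Pi>\<^sub>M i\<in>UNIV. borel))"
  unfolding gauss_law_def by (intro sets_pair_measure_cong) auto

lemma space_gauss_law [simp]: "space (gauss_law R K \<mu>) = space R \<times> UNIV"
  using sets_eq_imp_space_eq[OF sets_gauss_law[of R K \<mu>]]
  by (simp add: space_pair_measure space_PiM)

lemma prob_space_gauss_law: "prob_space R \<Longrightarrow> prob_space (gauss_law R K \<mu>)"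
  unfolding gauss_law_def
  by (intro prob_space_pair prob_space_PiM prob_space_gauss_table)

text \<open>The internal randomness is independent of the rewards and has the same law
  \<open>R\<close> on both sides, so a bound uniform in \<open>u\<close> survives integration over
  \<open>u\<close>.\<close>

lemma measure_pair_diff_le:
  assumes "prob_space R" "prob_space N" "prob_space N'" and sets: "sets N' = sets N"
    and A: "A \<in> sets (R \<Otimes>\<^sub>M N)" and c: "0 \<le> c"
    and le: "\<And>u. measure N' (Pair u -` A) \<le> measure N (Pair u -` A) + c"
  shows "measure (R \<Otimes>\<^sub>M N') A \<le> measure (R \<Otimes>\<^sub>M N) A + c"
proof -
  interpret R: prob_space R by fact
  interpret N: prob_space N by fact
  interpret N': prob_space N' by fact
  interpret RN: prob_space "R \<Otimes>\<^sub>M N" by (intro prob_space_pair) fact+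
  interpret RN': prob_space "R \<Otimes>\<^sub>M N'" by (intro prob_space_pair) fact+
  have A': "A \<in> sets (R \<Otimes>\<^sub>M N')" using A sets_pair_measure_cong[OF refl sets] by blast
  have "emeasure (R \<Otimes>\<^sub>M N') A = (\<integral>\<^sup>+u. emeasure N' (Pair u -` A) \<partial>R)"
    by (rule N'.emeasure_pair_measure_alt[OF A'])
  also have "\<dots> \<le> (\<integral>\<^sup>+u. emeasure N (Pair u -` A) + ennreal c \<partial>R)"
    using le c by (intro nn_integral_mono)
      (simp add: N.emeasure_eq_measure N'.emeasure_eq_measure ennreal_plus[symmetric] ennreal_leI del: ennreal_plus)
  also have "\<dots> = (\<integral>\<^sup>+u. emeasure N (Pair u -` A) \<partial>R) + ennreal c"
    by (subst nn_integral_add) (auto intro: N.measurable_emeasure_Pair[OF A] simp: R.emeasure_space_1)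
  also have "\<dots> = emeasure (R \<Otimes>\<^sub>M N) A + ennreal c"
    by (simp add: N.emeasure_pair_measure_alt[OF A])
  finally show ?thesis
    using c by (simp add: RN.emeasure_eq_measure RN'.emeasure_eq_measure ennreal_plus[symmetric] del: ennreal_plus)
qed

lemma gauss_law_event_diff_le:
  assumes R: "prob_space R" and j: "j < K" and A: "A \<in> sets (R \<Otimes>\<^sub>M (\<Pi>\<^sub>M i\<in>UNIV. borel))"
    and dep: "\<And>u x y. (\<And>i. i \<notin> {j} \<times> {n..} \<Longrightarrow> x i = y i) \<Longrightarrow> (u, x) \<in> A \<Longrightarrow> (u, y) \<in> A"
    and s: "exp (d\<^sup>2 * real n) \<le> 1 + s\<^sup>2" "0 < s"
  shows "\<bar>measure (gauss_law R K ((\<lambda>_. 0)(j := d))) A - measure (gauss_law R K (\<lambda>_. 0)) A\<bar> \<le> s / 2"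
proof -
  let ?N = "PiM UNIV (gauss_table K (\<lambda>_. 0))"
    and ?N' = "PiM UNIV (gauss_table K ((\<lambda>_. 0)(j := d)))"
  have *: "\<bar>measure ?N' (Pair u -` A) - measure ?N (Pair u -` A)\<bar> \<le> s / 2" for u
    using sets_Pair1[OF A, of u] by (intro table_event_diff_le[OF j _ _ s]) (use dep in \<open>blast+\<close>)
  have le: "measure ?N' (Pair u -` A) \<le> measure ?N (Pair u -` A) + s / 2"
    "measure ?N (Pair u -` A) \<le> measure ?N' (Pair u -` A) + s / 2" for u
    using *[of u] by linarith+
  have A1: "A \<in> sets (R \<Otimes>\<^sub>M ?N)" "A \<in> sets (R \<Otimes>\<^sub>M ?N')"
    using A sets_gauss_law[of R K] by (auto simp: gauss_law_def)
  have "measure (gauss_law R K ((\<lambda>_. 0)(j := d))) A \<le> measure (gauss_law R K (\<lambda>_. 0)) A + s / 2"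
    unfolding gauss_law_def using A1 s(2) le(1)
    by (intro measure_pair_diff_le R prob_space_PiM prob_space_gauss_table) auto
  moreover have "measure (gauss_law R K (\<lambda>_. 0)) A \<le> measure (gauss_law R K ((\<lambda>_. 0)(j := d))) A + s / 2"
    unfolding gauss_law_def using A1 s(2) le(2)
    by (intro measure_pair_diff_le R prob_space_PiM prob_space_gauss_table) auto
  ultimately show ?thesis by linarith
qed

section \<open>Pull counts and the samples on which a history depends\<close>

definition pulls :: "nat \<Rightarrow> (nat \<Rightarrow> nat) \<Rightarrow> nat \<Rightarrow> nat" where
  "pulls j I t = card {s. s < t \<and> I s = j}"

lemma pulls_eq_sum: "pulls j I t = (\<Sum>s<t. if I s = j then 1 else 0)"
  by (auto simp: pulls_def sum.If_cases lessThan_def Int_def)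

lemma pulls_le: "pulls j I t \<le> t"
  unfolding pulls_def using card_mono[of "{..<t}" "{s. s < t \<and> I s = j}"] by auto

lemma sum_pulls_le:
  assumes "finite J" shows "(\<Sum>j\<in>J. pulls j I t) \<le> t"
proof -
  have "(\<Sum>j\<in>J. pulls j I t) = (\<Sum>s<t. \<Sum>j\<in>J. if I s = j then 1 else 0)"
    unfolding pulls_eq_sum by (rule sum.swap)
  also have "\<dots> \<le> (\<Sum>s<t. 1)"
    using assms by (intro sum_mono) (simp add: sum.delta')
  finally show ?thesis by simp
qed

text \<open>The counter inside \<open>hist\<close> selects the next unread sample, so this ties
  \<open>pulls\<close> to the table entries read so far.\<close>

lemma length_filter_hist:
  "length (filter (\<lambda>p. fst p = j) (hist \<pi> K m u X t)) = pulls j (arm \<pi> K m u X) t"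
  by (induction t) (auto simp: pulls_eq_sum Let_def arm_def)

text \<open>While arm \<open>j\<close> has been pulled at most \<open>r\<close> times, no sample of
  it from index \<open>m j + r\<close> on has been read. The count is bounded for \<open>X\<close>
  only; the induction shows that \<open>Y\<close> produces the same run.\<close>

lemma hist_cong:
  assumes XY: "\<And>i. i \<notin> {j} \<times> {m j + r..} \<Longrightarrow> X i = Y i"
    and "pulls j (arm \<pi> K m u X) t \<le> r"
  shows "hist \<pi> K m u X t = hist \<pi> K m u Y t"
  using assms(2)
proof (induction t)
  case (Suc t)
  have off: "offline_view K m X = offline_view K m Y"
    unfolding offline_view_def by (intro ext) (auto intro!: XY)
  have "pulls j (arm \<pi> K m u X) t \<le> pulls j (arm \<pi> K m u X) (Suc t)"
    by (simp add: pulls_eq_sum)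
  with Suc have IH: "hist \<pi> K m u X t = hist \<pi> K m u Y t" by simp
  define h where "h = hist \<pi> K m u Y t"
  define a where "a = \<pi> u (offline_view K m Y) h"
  have a: "arm \<pi> K m u X t = a" by (simp add: arm_def a_def h_def off IH)
  have "X (a, m a + length (filter (\<lambda>p. fst p = a) h)) = Y (a, m a + length (filter (\<lambda>p. fst p = a) h))"
  proof (cases "a = j")
    \<comment> \<open>The bound counts the present pull too, so fewer than \<open>r\<close> pulls of
      \<open>j\<close> precede it and the index read is below \<open>m j + r\<close>.\<close>
    case True
    then have "pulls j (arm \<pi> K m u X) (Suc t) = Suc (pulls j (arm \<pi> K m u X) t)"
      using a by (simp add: pulls_eq_sum)
    then have "length (filter (\<lambda>p. fst p = j) h) < r"
      using Suc.prems length_filter_hist[of j \<pi> K m u X t] by (simp add: IH h_def)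
    then show ?thesis using True by (intro XY) auto
  next
    case False then show ?thesis by (intro XY) auto
  qed
  then show ?case by (simp add: Let_def IH off a_def h_def)
qed simp

text \<open>The decision at index \<open>t\<close> is preceded by only \<open>t\<close> rounds. For
  \<open>t < T\<close> this gives \<open>r = T - 1\<close>, the source of \<open>T - 1\<close> in
  the bound: the last reward influences no decision.\<close>

lemma arm_cong:
  assumes "\<And>i. i \<notin> {j} \<times> {m j + r..} \<Longrightarrow> X i = Y i" and "t \<le> r"
  shows "arm \<pi> K m u X t = arm \<pi> K m u Y t"
proof -
  have "offline_view K m X = offline_view K m Y"
    unfolding offline_view_def by (intro ext) (auto intro!: assms(1))
  moreover have "hist \<pi> K m u X t = hist \<pi> K m u Y t"
    using assms pulls_le[of j "arm \<pi> K m u X" t] by (intro hist_cong[where r=r]) auto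
  ultimately show ?thesis by (simp add: arm_def)
qed

lemma pulls_le_cong:
  assumes "\<And>i. i \<notin> {j} \<times> {m j + r..} \<Longrightarrow> X i = Y i" and "pulls j (arm \<pi> K m u X) t \<le> r"
  shows "pulls j (arm \<pi> K m u Y) t \<le> r"
  using assms(2) hist_cong[of j m r X Y \<pi> K u t, OF assms]
  by (simp flip: length_filter_hist)

section \<open>Regret in instances with one perturbed arm\<close>

lemma exp_regret_le_worst_regret:
  "exp_regret R \<pi> K m (\<lambda>i. gauss (\<mu> i)) T \<le> worst_regret R \<pi> K m T"
  unfolding worst_regret_def by (rule SUP_upper) (simp add: instances_def subgaussian1_gauss)

lemma pseudo_regret_best_arm:
  assumes "j < K" "0 \<le> d"
  shows "pseudo_regret K (\<lambda>i. gauss (((\<lambda>_. 0)(j := d)) i)) T I = (\<Sum>t<T. d * indicator {t. I t \<noteq> j} t)"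
proof -
  have "Max {mean (gauss (((\<lambda>_. 0)(j := d)) i)) | i. i < K} = d"
    using assms by (intro Max_eqI) (auto simp: mean_gauss intro!: exI[of _ j])
  then show ?thesis
    unfolding pseudo_regret_def by (intro sum.cong) (auto simp: mean_gauss)
qed

lemma pseudo_regret_worst_arm:
  assumes "j < K" "K \<ge> 2" "0 \<le> d"
  shows "pseudo_regret K (\<lambda>i. gauss (((\<lambda>_. 0)(j := - d)) i)) T I = (\<Sum>t<T. d * indicator {t. I t = j} t)"
proof -
  \<comment> \<open>A second arm keeps the optimal mean at 0 when arm \<open>j\<close> is
    lowered.\<close>
  have "\<exists>i<K. i \<noteq> j" using assms by (intro exI[of _ "if j = 0 then 1 else 0"]) auto
  then have "Max {mean (gauss (((\<lambda>_. 0)(j := - d)) i)) | i. i < K} = 0"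
    using assms by (intro Max_eqI) (auto simp: mean_gauss)
  then show ?thesis
    unfolding pseudo_regret_def by (intro sum.cong) (auto simp: mean_gauss)
qed

lemma (in prob_space) nn_integral_sum_indicator:
  assumes "0 \<le> d" "\<And>t. t < T \<Longrightarrow> B t \<in> sets M"
  shows "(\<integral>\<^sup>+x. ennreal (\<Sum>t<T. d * indicator (B t) x) \<partial>M) = ennreal (\<Sum>t<T. d * prob (B t))"
proof -
  have "(\<integral>\<^sup>+x. ennreal (\<Sum>t<T. d * indicator (B t) x) \<partial>M)
      = ennreal (expectation (\<lambda>x. \<Sum>t<T. d * indicator (B t) x))"
    using assms by (intro nn_integral_eq_integral) (auto intro!: sum_nonneg simp: emeasure_eq_measure)
  also have "expectation (\<lambda>x. \<Sum>t<T. d * indicator (B t) x) = (\<Sum>t<T. d * prob (B t))"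
    using assms by (subst Bochner_Integration.integral_sum) (auto simp: emeasure_eq_measure)
  finally show ?thesis .
qed

section \<open>Regret lower bounds for a fixed algorithm\<close>

context
  fixes R :: "'u measure" and \<pi> :: "'u \<Rightarrow> (nat \<Rightarrow> nat \<Rightarrow> real) \<Rightarrow> history \<Rightarrow> nat"
    and K :: nat and m :: "nat \<Rightarrow> nat"
  assumes valid: "valid_algorithm R \<pi> K m"
begin

lemma prob_space_R: "prob_space R"
  using valid by (simp add: valid_algorithm_def)

lemma measurable_arm [measurable]:
  "(\<lambda>\<omega>. arm \<pi> K m (fst \<omega>) (snd \<omega>) t) \<in> measurable (R \<Otimes>\<^sub>M (\<Pi>\<^sub>M j\<in>UNIV. borel)) (count_space UNIV)"
  using valid by (simp add: valid_algorithm_def)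

lemma measurable_pulls [measurable]:
  "(\<lambda>\<omega>. pulls j (arm \<pi> K m (fst \<omega>) (snd \<omega>)) t) \<in> measurable (R \<Otimes>\<^sub>M (\<Pi>\<^sub>M j\<in>UNIV. borel)) (count_space UNIV)"
  unfolding pulls_eq_sum by measurable

text \<open>Raising arm \<open>j\<close> penalises the rounds that avoid it, lowering it those that
  pull it. Each instance is within \<open>s / 2\<close> of the unperturbed one on
  \<open>I(t) = j\<close>, so the two error probabilities sum to at least \<open>1 - s\<close> in
  every round, and one of the two regrets is at least the average.\<close>

lemma worst_regret_ge_two_point:
  assumes K: "K \<ge> 2" and T: "T \<ge> 1" and j: "j < K" and d: "0 \<le> d"
    and s: "0 < s" "exp (d\<^sup>2 * real (T - 1 + m j)) \<le> 1 + s\<^sup>2"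
  shows "ennreal (d * T * (1 - s) / 2) \<le> worst_regret R \<pi> K m T"
proof -
  define W where "W = space R \<times> (UNIV :: (nat \<times> nat \<Rightarrow> real) set)"
  define B where "B t = {\<omega> \<in> W. arm \<pi> K m (fst \<omega>) (snd \<omega>) t = j}" for t
  let ?a = "\<lambda>\<omega>. arm \<pi> K m (fst \<omega>) (snd \<omega>)"
  have W: "W = space (R \<Otimes>\<^sub>M (\<Pi>\<^sub>M j\<in>UNIV. borel))" by (simp add: W_def space_pair_measure space_PiM)
  have B: "B t \<in> sets (R \<Otimes>\<^sub>M (\<Pi>\<^sub>M j\<in>UNIV. borel))" for t
    unfolding B_def W by measurable
  let ?P = "gauss_law R K"
  interpret P: prob_space "?P \<mu>" for \<mu> by (rule prob_space_gauss_law[OF prob_space_R])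
  \<comment> \<open>The likelihood bound involves only the square of the shift, so it serves both
    signs.\<close>
  have diff: "\<bar>measure (?P ((\<lambda>_. 0)(j := e))) (B t) - measure (?P (\<lambda>_. 0)) (B t)\<bar> \<le> s / 2"
    if t: "t < T" and e: "e\<^sup>2 = d\<^sup>2" for t e
  proof (rule gauss_law_event_diff_le[OF prob_space_R j B, where n="T - 1 + m j"])
    show "(u, y) \<in> B t" if "\<And>i. i \<notin> {j} \<times> {T - 1 + m j..} \<Longrightarrow> x i = y i" "(u, x) \<in> B t" for u x y
      using that arm_cong[of j m "T - 1" x y t \<pi> K u] t
      by (simp add: B_def W_def add.commute)
  qed (use s e in auto)
  define p where "p = (\<Sum>t<T. measure (?P ((\<lambda>_. 0)(j := d))) (W - B t))"
  define q where "q = (\<Sum>t<T. measure (?P ((\<lambda>_. 0)(j := - d))) (B t))"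
  have "exp_regret R \<pi> K m (\<lambda>i. gauss (((\<lambda>_. 0)(j := d)) i)) T
      = (\<integral>\<^sup>+\<omega>. ennreal (\<Sum>t<T. d * indicator (W - B t) \<omega>) \<partial>?P ((\<lambda>_. 0)(j := d)))"
    unfolding exp_regret_def sample_space_gauss pseudo_regret_best_arm[OF j d]
    by (intro nn_integral_cong) (auto simp: B_def W_def indicator_def intro!: sum.cong arg_cong[where f=ennreal])
  also have "\<dots> = ennreal (d * p)"
    using B d by (subst P.nn_integral_sum_indicator) (auto simp: p_def sum_distrib_left W)
  finally have 1: "ennreal (d * p) \<le> worst_regret R \<pi> K m T"
    using exp_regret_le_worst_regret[of R \<pi> K m "(\<lambda>_. 0)(j := d)" T] by simp
  have "exp_regret R \<pi> K m (\<lambda>i. gauss (((\<lambda>_. 0)(j := - d)) i)) T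
      = (\<integral>\<^sup>+\<omega>. ennreal (\<Sum>t<T. d * indicator (B t) \<omega>) \<partial>?P ((\<lambda>_. 0)(j := - d)))"
    unfolding exp_regret_def sample_space_gauss pseudo_regret_worst_arm[OF j K d]
    by (intro nn_integral_cong) (auto simp: B_def W_def indicator_def intro!: sum.cong arg_cong[where f=ennreal])
  also have "\<dots> = ennreal (d * q)"
    using B d by (subst P.nn_integral_sum_indicator) (auto simp: q_def sum_distrib_left)
  finally have 2: "ennreal (d * q) \<le> worst_regret R \<pi> K m T"
    using exp_regret_le_worst_regret[of R \<pi> K m "(\<lambda>_. 0)(j := - d)" T] by simp
  have "T * (1 - s) = (\<Sum>t<T. 1 - s)" by simp
  also have "\<dots> \<le> (\<Sum>t<T. measure (?P ((\<lambda>_. 0)(j := d))) (W - B t) + measure (?P ((\<lambda>_. 0)(j := - d))) (B t))"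
  proof (intro sum_mono)
    fix t assume "t \<in> {..<T}"
    then have t: "t < T" by simp
    have "measure (?P ((\<lambda>_. 0)(j := d))) (W - B t) = 1 - measure (?P ((\<lambda>_. 0)(j := d))) (B t)"
      using P.prob_compl[of "B t" "(\<lambda>_. 0)(j := d)"] B by (simp add: W_def)
    moreover have "\<bar>measure (?P ((\<lambda>_. 0)(j := d))) (B t) - measure (?P (\<lambda>_. 0)) (B t)\<bar> \<le> s / 2"
      and "\<bar>measure (?P ((\<lambda>_. 0)(j := - d))) (B t) - measure (?P (\<lambda>_. 0)) (B t)\<bar> \<le> s / 2"
      by (rule diff[OF t], simp)+
    ultimately show "1 - s \<le> measure (?P ((\<lambda>_. 0)(j := d))) (W - B t) + measure (?P ((\<lambda>_. 0)(j := - d))) (B t)"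
      by linarith
  qed
  finally have "T * (1 - s) \<le> p + q" by (simp add: p_def q_def sum.distrib)
  then have "d * (T * (1 - s)) \<le> d * (p + q)" using d by (intro mult_left_mono)
  then have "d * T * (1 - s) / 2 \<le> d * p \<or> d * T * (1 - s) / 2 \<le> d * q"
    by (simp add: algebra_simps) linarith
  then show ?thesis using 1 2 by (meson ennreal_leI order_trans)
qed

text \<open>At most \<open>r\<close> pulls of the raised arm cost at least
  \<open>d * (T - r)\<close>. The probability is taken in the unperturbed instance, which is the
  same for every \<open>j\<close>, so that it can be averaged over arms.\<close>

lemma worst_regret_ge_truncated:
  assumes j: "j < K" and d: "0 \<le> d" and r: "r \<le> T"
    and s: "0 < s" "exp (d\<^sup>2 * real (m j + r)) \<le> 1 + s\<^sup>2"
  shows "ennreal (d * (real T - r) *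
      (1 - measure (gauss_law R K (\<lambda>_. 0)) {\<omega> \<in> space R \<times> UNIV. r < pulls j (arm \<pi> K m (fst \<omega>) (snd \<omega>)) T} - s / 2))
    \<le> worst_regret R \<pi> K m T"
proof -
  define W where "W = space R \<times> (UNIV :: (nat \<times> nat \<Rightarrow> real) set)"
  define B where "B = {\<omega> \<in> W. pulls j (arm \<pi> K m (fst \<omega>) (snd \<omega>)) T \<le> r}"
  let ?C = "{\<omega> \<in> W. r < pulls j (arm \<pi> K m (fst \<omega>) (snd \<omega>)) T}"
  have W: "W = space (R \<Otimes>\<^sub>M (\<Pi>\<^sub>M j\<in>UNIV. borel))" by (simp add: W_def space_pair_measure space_PiM)
  have B: "B \<in> sets (R \<Otimes>\<^sub>M (\<Pi>\<^sub>M j\<in>UNIV. borel))"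
    unfolding B_def W by measurable
  let ?P = "gauss_law R K" and ?\<mu> = "(\<lambda>_. 0)(j := d) :: nat \<Rightarrow> real"
  interpret P: prob_space "?P \<mu>" for \<mu> by (rule prob_space_gauss_law[OF prob_space_R])
  have "\<bar>measure (?P ?\<mu>) B - measure (?P (\<lambda>_. 0)) B\<bar> \<le> s / 2"
  proof (rule gauss_law_event_diff_le[OF prob_space_R j B, where n="m j + r"])
    show "(u, y) \<in> B" if "\<And>i. i \<notin> {j} \<times> {m j + r..} \<Longrightarrow> x i = y i" "(u, x) \<in> B" for u x y
      using that pulls_le_cong[of j m r x y \<pi> K u T] by (simp add: B_def W_def)
  qed (use s in auto)
  moreover have "measure (?P (\<lambda>_. 0)) ?C = 1 - measure (?P (\<lambda>_. 0)) B"
  proof -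
    have "?C = W - B" by (auto simp: B_def)
    then show ?thesis using P.prob_compl[of B "\<lambda>_. 0"] B by (simp add: W_def)
  qed
  ultimately have PB: "1 - measure (?P (\<lambda>_. 0)) ?C - s / 2 \<le> measure (?P ?\<mu>) B" by linarith
  have "ennreal (d * (real T - r) * (1 - measure (?P (\<lambda>_. 0)) ?C - s / 2))
      \<le> ennreal (d * (real T - r) * measure (?P ?\<mu>) B)"
    using PB d r by (intro ennreal_leI mult_left_mono) auto
  also have "\<dots> = ennreal (d * (real T - r)) * emeasure (?P ?\<mu>) B"
    using d r by (simp add: ennreal_mult P.emeasure_eq_measure)
  also have "\<dots> = (\<integral>\<^sup>+\<omega>. ennreal (d * (real T - r)) * indicator B \<omega> \<partial>?P ?\<mu>)"
    using B by (subst nn_integral_cmult_indicator) auto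
  also have "\<dots> \<le> exp_regret R \<pi> K m (\<lambda>i. gauss (?\<mu> i)) T"
    unfolding exp_regret_def sample_space_gauss
  proof (intro nn_integral_mono)
    fix \<omega>
    let ?I = "arm \<pi> K m (fst \<omega>) (snd \<omega>)"
    have "(\<Sum>t<T. d * indicator {t. ?I t \<noteq> j} t) = (\<Sum>t<T. d * (1 - (if ?I t = j then 1 else 0)))"
      by (intro sum.cong) auto
    also have "\<dots> = d * (real T - pulls j ?I T)"
      by (simp add: pulls_eq_sum sum_distrib_left[symmetric] sum_subtractf of_nat_sum if_distrib[of real] cong: if_cong)
    finally have "pseudo_regret K (\<lambda>i. gauss (?\<mu> i)) T ?I = d * (real T - pulls j ?I T)"
      unfolding pseudo_regret_best_arm[OF j d] .
    moreover have "d * (real T - r) \<le> d * (real T - pulls j ?I T)" if "\<omega> \<in> B"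
      using that d by (intro mult_left_mono) (auto simp: B_def)
    ultimately show "ennreal (d * (real T - r)) * indicator B \<omega>
        \<le> ennreal (pseudo_regret K (\<lambda>i. gauss (?\<mu> i)) T ?I)"
      by (auto simp: indicator_def intro!: ennreal_leI)
  qed
  also have "\<dots> \<le> worst_regret R \<pi> K m T" by (rule exp_regret_le_worst_regret)
  finally show ?thesis by (simp add: W_def)
qed

text \<open>Markov's inequality summed over arms, with the total number of pulls at most
  \<open>T\<close>. Integrality of the counts improves \<open>r\<close> to \<open>r + 1\<close>,
  which also covers \<open>r = 0\<close>.\<close>

lemma sum_prob_pulls_gt_le:
  assumes "finite J"
  shows "(\<Sum>j\<in>J. measure (gauss_law R K \<mu>) {\<omega> \<in> space R \<times> UNIV. r < pulls j (arm \<pi> K m (fst \<omega>) (snd \<omega>)) T})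
    \<le> real T / (real r + 1)"
proof -
  let ?C = "\<lambda>j. {\<omega> \<in> space R \<times> UNIV. r < pulls j (arm \<pi> K m (fst \<omega>) (snd \<omega>)) T}"
  interpret P: prob_space "gauss_law R K \<mu>" by (rule prob_space_gauss_law[OF prob_space_R])
  have W: "space R \<times> UNIV = space (R \<Otimes>\<^sub>M (\<Pi>\<^sub>M j\<in>(UNIV :: (nat \<times> nat) set). (borel :: real measure)))"
    by (simp add: space_pair_measure space_PiM)
  have C: "?C j \<in> sets (R \<Otimes>\<^sub>M (\<Pi>\<^sub>M j\<in>UNIV. borel))" for j
    unfolding W by measurable
  have "(\<Sum>j\<in>J. measure (gauss_law R K \<mu>) (?C j)) = P.expectation (\<lambda>\<omega>. \<Sum>j\<in>J. indicator (?C j) \<omega>)"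
    using C by (subst Bochner_Integration.integral_sum)
      (auto simp: P.emeasure_eq_measure intro!: sum.cong arg_cong[where f="P.prob"])
  also have "\<dots> \<le> P.expectation (\<lambda>\<omega>. real T / (real r + 1))"
  proof (rule integral_mono)
    fix \<omega>
    let ?n = "\<lambda>j. pulls j (arm \<pi> K m (fst \<omega>) (snd \<omega>)) T"
    have "(\<Sum>j\<in>J. indicator (?C j) \<omega>) \<le> (\<Sum>j\<in>J. real (?n j) / (real r + 1))"
      by (intro sum_mono) (auto simp: indicator_def)
    also have "\<dots> = real (\<Sum>j\<in>J. ?n j) / (real r + 1)" by (simp add: sum_divide_distrib)
    also have "\<dots> \<le> real T / (real r + 1)"
      using sum_pulls_le[OF assms, of "arm \<pi> K m (fst \<omega>) (snd \<omega>)" T] by (intro divide_right_mono) (simp_all del: of_nat_sum)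
    finally show "(\<Sum>j\<in>J. indicator (?C j) \<omega>) \<le> real T / (real r + 1)" .
  qed (use C in \<open>auto simp: P.emeasure_eq_measure\<close>)
  also have "\<dots> = real T / (real r + 1)" using P.prob_space by simp
  finally show ?thesis .
qed

text \<open>With a single round and no data on arm \<open>j\<close>, shifts of any size are
  undetectable, so the regret is unbounded.\<close>

lemma worst_regret_infinite:
  assumes "K \<ge> 2" "j < K" "m j = 0"
  shows "worst_regret R \<pi> K m 1 = \<top>"
proof (rule ccontr)
  assume "worst_regret R \<pi> K m 1 \<noteq> \<top>"
  then obtain w where w: "worst_regret R \<pi> K m 1 = ennreal w" "0 \<le> w"
    by (cases "worst_regret R \<pi> K m 1") auto
  \<comment> \<open>With \<open>s = 1/2\<close> the shift \<open>4 * w + 4\<close> forces regret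
    \<open>w + 1\<close>, exceeding the supposed finite value \<open>w\<close>.\<close>
  have "ennreal ((4 * w + 4) * real 1 * (1 - 1/2) / 2) \<le> worst_regret R \<pi> K m 1"
    using assms w by (intro worst_regret_ge_two_point) auto
  then show False using w by simp
qed

lemma worst_regret_ge_small:
  assumes K: "K \<ge> 2" and T: "T \<ge> 1" and j: "j < K" and n: "T - 1 + m j > 0"
  shows "ennreal (11 / 100 * T / sqrt (real (T - 1 + m j))) \<le> worst_regret R \<pi> K m T"
proof -
  define n where "n = T - 1 + m j"
  define d where "d = 1 / (2 * sqrt n)"
  have "n > 0" using assms by (simp add: n_def)
  then have d: "0 \<le> d" "d\<^sup>2 * n = 1 / 4" by (auto simp: d_def power_divide power_mult_distrib)
  have "exp (1 / 4 :: real) \<le> 1 + 1 / 4 + (1 / 4)\<^sup>2" by (rule exp_bound) auto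
  \<comment> \<open>\<open>14 / 25\<close> is a rational slightly above \<open>sqrt (5/16)\<close>;
    the resulting constant is \<open>1/2 * 11/25 / 2 = 11/100\<close>.\<close>
  then have "exp (d\<^sup>2 * n) \<le> 1 + (14 / 25)\<^sup>2" unfolding d by (simp add: power2_eq_square)
  then have "ennreal (d * T * (1 - 14 / 25) / 2) \<le> worst_regret R \<pi> K m T"
    using d j by (intro worst_regret_ge_two_point K T) (auto simp: n_def)
  also have "d * T * (1 - 14 / 25) / 2 = 11 / 100 * T / sqrt n" by (simp add: d_def)
  finally show ?thesis by (simp add: n_def)
qed

lemma worst_regret_ge_large:
  assumes T: "T \<ge> 1" and J: "J \<subseteq> {..<K}" "card J \<ge> 12" and n: "T - 1 + sum m J > 0"
  shows "ennreal (1 / 27 * T * sqrt (real (card J) / real (T - 1 + sum m J))) \<le> worst_regret R \<pi> K m T"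
proof -
  define k where "k = card J"
  define n where "n = T - 1 + sum m J"
  \<comment> \<open>About four times the average number of pulls over \<open>J\<close>, so Markov
    leaves a sum of at most \<open>k / 4 + 1\<close>. The assumption \<open>k \<ge> 12\<close> makes
    this at most \<open>k / 3\<close> and also gives \<open>r \<le> T / 3\<close>.\<close>
  define r where "r = 4 * (T - 1) div k"
  define d where "d = sqrt (k / n) / 6"
  have k: "k \<ge> 12" and npos: "n > 0" using assms by (auto simp: k_def n_def)
  have fin: "finite J" using J(1) finite_subset by blast
  have d: "0 \<le> d" "d\<^sup>2 = k / n / 36" by (auto simp: d_def power_divide)
  let ?p = "\<lambda>j. measure (gauss_law R K (\<lambda>_. 0)) {\<omega> \<in> space R \<times> UNIV. r < pulls j (arm \<pi> K m (fst \<omega>) (snd \<omega>)) T}"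
  define x where "x j = d\<^sup>2 * real (m j + r)" for j
  have kr: "k * r \<le> 4 * (T - 1)" unfolding r_def by simp
  have kr1: "4 * (T - 1) \<le> k * (r + 1)"
  proof -
    have "4 * (T - 1) < k * (r + 1)"
      unfolding r_def using k dividend_less_times_div[of k "4 * (T - 1)"] by simp
    then show ?thesis by simp
  qed
  have r: "real r \<le> T / 3"
  proof -
    have "12 * r \<le> k * r" using k by simp
    with kr show ?thesis by linarith
  qed
  have "(\<Sum>j\<in>J. ?p j) \<le> real T / (real r + 1)" using fin by (rule sum_prob_pulls_gt_le)
  also have "\<dots> \<le> k / 4 + 1"
  proof -
    have "real (4 * (T - 1)) \<le> real (k * (r + 1))" using kr1 by (rule of_nat_mono)
    then have "real T \<le> real k * (real r + 1) / 4 + 1 * (real r + 1)" using T by (simp add: of_nat_diff field_simps)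
    also have "\<dots> = (k / 4 + 1) * (real r + 1)" by (simp add: field_simps)
    finally show ?thesis by (subst pos_divide_le_eq) auto
  qed
  also have "\<dots> \<le> k / 3" using k by simp
  finally have p: "(\<Sum>j\<in>J. ?p j) \<le> k / 3" .
  have "(\<Sum>j\<in>J. x j) = d\<^sup>2 * real (sum m J + k * r)"
    by (simp add: x_def sum_distrib_left[symmetric] sum.distrib k_def)
  also have "\<dots> \<le> d\<^sup>2 * real (4 * n)"
    using kr by (intro mult_left_mono of_nat_mono) (auto simp: n_def)
  also have "\<dots> = k / 9" using npos by (simp add: d)
  finally have "(\<Sum>j\<in>J. x j) \<le> k / 9" .
  \<comment> \<open>The weight \<open>3 / 2\<close> comes from \<open>sqrt y \<le> 1 / 6 + 3 / 2 * y\<close>, tangent at the average \<open>y = 1 / 9\<close>: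
    this makes the bound on the change of probability linear in \<open>x j\<close>, so that it can be averaged.\<close>
  moreover have "(\<Sum>j\<in>J. ?p j + 3 / 2 * x j) = (\<Sum>j\<in>J. ?p j) + 3 / 2 * (\<Sum>j\<in>J. x j)"
    by (simp only: sum.distrib sum_distrib_left)
  moreover have "(\<Sum>j\<in>J. 1 / 2) = real k / 2" by (simp add: k_def)
  ultimately have "(\<Sum>j\<in>J. ?p j + 3 / 2 * x j) \<le> (\<Sum>j\<in>J. 1 / 2)"
    using p by linarith
  moreover have "J \<noteq> {}" using k k_def by auto
  ultimately obtain j where j: "j \<in> J" "?p j + 3 / 2 * x j \<le> 1 / 2"
    using sum_strict_mono[OF fin, of "\<lambda>_. 1 / 2" "\<lambda>j. ?p j + 3 / 2 * x j"] by (meson not_le)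
  have x0: "0 \<le> x j" by (simp add: x_def)
  have "0 \<le> ?p j" by (rule measure_nonneg)
  with j(2) have x1: "x j \<le> 1" by linarith
  have "exp (x j) \<le> 1 + x j + (x j)\<^sup>2" using x0 x1 by (rule exp_bound)
  \<comment> \<open>The choice \<open>s = 1 / 3 + 3 * x j\<close> makes the loss
    \<open>s / 2\<close> equal to \<open>1 / 6 + 3 / 2 * x j\<close>, matching the averaged
    quantity; the probability that remains is at least \<open>1 - 1/2 - 1/6 = 1/3\<close>.\<close>
  also have "\<dots> \<le> 1 + (1 / 3 + 3 * x j)\<^sup>2"
  proof -
    have "(1 / 3 + 3 * x j)\<^sup>2 = 1 / 9 + 2 * x j + 9 * (x j)\<^sup>2"
      by (simp add: power2_eq_square algebra_simps)
    then show ?thesis using x0 zero_le_power2[of "x j"] by linarith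
  qed
  finally have "ennreal (d * (real T - r) * (1 - ?p j - (1 / 3 + 3 * x j) / 2)) \<le> worst_regret R \<pi> K m T"
    using j(1) J(1) d(1) r x0 unfolding x_def by (intro worst_regret_ge_truncated) (auto intro: add_pos_nonneg)
  moreover have "d * (2 / 3 * T) * (1 / 3) \<le> d * (real T - r) * (1 - ?p j - (1 / 3 + 3 * x j) / 2)"
  proof (intro mult_mono mult_left_mono)
    show "1 / 3 \<le> 1 - ?p j - (1 / 3 + 3 * x j) / 2" using j(2) by (simp add: field_simps)
  qed (use d r in auto)
  ultimately have "ennreal (d * (2 / 3 * T) * (1 / 3)) \<le> worst_regret R \<pi> K m T"
    by (meson ennreal_leI order_trans)
  also have "d * (2 / 3 * T) * (1 / 3) = 1 / 27 * T * sqrt (k / n)" by (simp add: d_def)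
  finally show ?thesis by (simp add: k_def n_def)
qed

end

section \<open>Case distinction on the maximising set of arms\<close>

theorem theorem2:
  fixes R :: "'u measure"
    and \<pi> :: "'u \<Rightarrow> (nat \<Rightarrow> nat \<Rightarrow> real) \<Rightarrow> history \<Rightarrow> nat"
    and K T :: nat and m :: "nat \<Rightarrow> nat"
  assumes "K \<ge> 2" and "T \<ge> 1" and "valid_algorithm R \<pi> K m"
  shows "worst_regret R \<pi> K m T \<ge> lower_bound K m T"
proof -
  let ?S = "{of_nat (card J) / of_nat (T - 1 + sum m J) | J. J \<subseteq> {..<K}} :: ennreal set"
  have "?S = (\<lambda>J. of_nat (card J) / of_nat (T - 1 + sum m J)) ` Pow {..<K}" by auto
  then have "finite ?S" "?S \<noteq> {}" by auto
  then have "Max ?S \<in> ?S" by (rule Max_in)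
  then obtain J where J: "J \<subseteq> {..<K}" "Max ?S = of_nat (card J) / of_nat (T - 1 + sum m J)" by blast
  have fin: "finite J" using J(1) finite_subset by blast
  define n where "n = T - 1 + sum m J"
  show ?thesis
  proof (cases "J = {}")
    \<comment> \<open>The empty set has ratio 0 even for a vanishing denominator, since
      \<open>0 / 0 = 0\<close> in \<open>ennreal\<close>.\<close>
    case True
    then have "lower_bound K m T = 0" unfolding lower_bound_def J(2) by (simp add: ennsqrt_def)
    then show ?thesis by simp
  next
    case False
    then obtain j where j: "j \<in> J" by auto
    then have jK: "j < K" using J(1) by auto
    have mj: "m j \<le> sum m J" using fin j by (intro member_le_sum) auto
    show ?thesis
    proof (cases "T - 1 + m j = 0")
      case True
      then have "T = 1" using assms(2) by simp
      then show ?thesis using worst_regret_infinite[OF assms(3,1) jK] True by simp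
    next
      case nj: False
      then have n: "n > 0" using mj unfolding n_def by linarith
      have "(of_nat (card J) / of_nat n :: ennreal) = ennreal (card J / n)"
        using n by (simp add: ennreal_of_nat_eq_real_of_nat divide_ennreal)
      then have "lower_bound K m T = ennreal (1 / 31 * T * sqrt (card J / n))"
        unfolding lower_bound_def J(2) n_def[symmetric]
        by (simp add: ennsqrt_def ennreal_of_nat_eq_real_of_nat ennreal_mult[symmetric])
      also have "\<dots> \<le> worst_regret R \<pi> K m T"
      proof (cases "card J \<ge> 12")
        case True
        have "1 / 31 * T * sqrt (card J / n) \<le> 1 / 27 * T * sqrt (card J / n)"
          by (intro mult_right_mono) auto
        also have "ennreal \<dots> \<le> worst_regret R \<pi> K m T"
          using worst_regret_ge_large[OF assms(3,2) J(1) True] n by (simp add: n_def)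
        finally show ?thesis by (simp add: ennreal_leI)
      next
        case False
        \<comment> \<open>Keeping one arm of \<open>J\<close> only decreases the denominator, and
          \<open>card J \<le> 11\<close>. The number \<open>341 / 100\<close> is
          \<open>31 * 11 / 100\<close>, just what \<open>worst_regret_ge_small\<close> allows, and
          it exceeds \<open>sqrt 11\<close>.\<close>
        have "sqrt (card J / n) \<le> sqrt (11 / real (T - 1 + m j))"
          using False mj nj by (intro real_sqrt_le_mono frac_le of_nat_mono) (auto simp: n_def)
        also have "\<dots> \<le> 341 / 100 / sqrt (real (T - 1 + m j))"
        proof -
          have "sqrt 11 \<le> 341 / 100" by (rule real_le_lsqrt) (auto simp: power2_eq_square)
          then show ?thesis unfolding real_sqrt_divide by (rule divide_right_mono) simp
        qed
        finally have "1 / 31 * T * sqrt (card J / n) \<le> 1 / 31 * T * (341 / 100 / sqrt (real (T - 1 + m j)))"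
          by (intro mult_left_mono) auto
        also have "\<dots> = 11 / 100 * T / sqrt (real (T - 1 + m j))" by simp
        finally show ?thesis
          using worst_regret_ge_small[OF assms(3,1,2) jK] nj by (meson ennreal_leI order_trans not_gr_zero)
      qed
      finally show ?thesis .
    qed
  qed
qed

end
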